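(* Let $n$ be a nonnegative integer with $n \equiv 1, 2 \pmod 4$ (that is, $n\equiv 1$ or $n\equiv 2 \pmod 4$). Then $$s(9n) - 3 s(n) = 2\,(1,1,3,0,0,1)(n).$$
   Context: For integers $a,b,c,d,e,f$, $(a,b,c,d,e,f)(n)$ denotes the number of representations of $n$ by the ternary quadratic form $ax^2+by^2+cz^2+dyz+ezx+fxy$, i.e. the number of triples $(x,y,z)\in\mathbb{Z}^3$ with $ax^2+by^2+cz^2+dyz+ezx+fxy=n$. In particular $(1,1,3,0,0,1)(n)$ counts $(x,y,z)\in\mathbb{Z}^3$ with $x^2+y^2+3z^2+xy=n$. $s(n)$ denotes the number of triples $(x,y,z)\in\mathbb{Z}^3$ with $x^2+y^2+z^2=n$. *)

theory Defs
  imports Complex_Main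
begin

(* Representation counts are taken with card, so the value is meaningful whenever the
   set of representations is finite, in particular for every positive definite form. *)

definition ternary_reps :: "int \<Rightarrow> int \<Rightarrow> int \<Rightarrow> int \<Rightarrow> int \<Rightarrow> int \<Rightarrow> nat \<Rightarrow> nat" where
  "ternary_reps a b c d e f n =
     card {(x :: int, y :: int, z :: int).
       a * x\<^sup>2 + b * y\<^sup>2 + c * z\<^sup>2 + d * y * z + e * z * x + f * x * y = int n}"

definition three_squares_reps :: "nat \<Rightarrow> nat" where
  "three_squares_reps n = card {(x :: int, y :: int, z :: int). x\<^sup>2 + y\<^sup>2 + z\<^sup>2 = int n}"

end

theory Submission
  imports Defs "HOL-Computational_Algebra.Formal_Power_Series"
begin

text \<open>Write \<open>\<phi>(q)\<close> for the theta series of the squares and \<open>a(q)\<close> for that of \<open>x\<^sup>2 + x y + y\<^sup>2\<close>.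
  Reflecting in the vectors \<open>(1, \<plusminus>1, \<plusminus>1)\<close> gives \<open>s(9n) = 5 s(n) - 4 T(n)\<close>, where \<open>T(n)\<close> counts the
  vectors of norm \<open>n\<close> with coordinate sum divisible by 3 and has generating function
  \<open>a(q\<^sup>2) \<phi>(q\<^sup>3)\<close>. So the claim is a consequence of
  \<open>\<phi>(q)\<^sup>3 = \<phi>(q\<^sup>3) (2 a(q\<^sup>2) + a(q) - 2 a(q\<^sup>4))\<close>, because \<open>4 x\<^sup>2 + 4 x y + 4 y\<^sup>2 + 3 z\<^sup>2\<close> is never
  1 or 2 modulo 4. The quadratic spaces of \<open>\<phi>(q)\<^sup>3\<close> and \<open>\<phi>(q\<^sup>3) a(q)\<close> are not isometric, so no bijection of
  lattice vectors proves this identity directly. But lattice bijections do express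
  \<open>\<phi>(q) \<phi>(q\<^sup>3)\<close>, \<open>a(q\<^sup>2)\<^sup>2\<close> and \<open>a(q\<^sup>2) \<phi>(q) \<phi>(q\<^sup>3)\<close> through the other series, and these three relations imply
  \<open>(\<phi>(q)\<^sup>4 - 3 \<phi>(q\<^sup>3)\<^sup>4)\<^sup>2 = (2 \<phi>(q) \<phi>(q\<^sup>3) (a(q) - 2 a(q\<^sup>4)))\<^sup>2\<close>. The constant terms decide the sign
  of the square root.\<close>

section \<open>Theta series of proper functions\<close>

definition theta :: "'a set \<Rightarrow> ('a \<Rightarrow> int) \<Rightarrow> int fps" where
  "theta A Q = Abs_fps (\<lambda>n. int (card {s \<in> A. Q s = int n}))"

text \<open>Finite level sets make the coefficients of \<open>theta\<close> genuine counts, and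
  nonnegative values make products of such series finite convolutions.\<close>

definition proper :: "('a \<Rightarrow> int) \<Rightarrow> bool" where
  "proper Q \<longleftrightarrow> (\<forall>s. 0 \<le> Q s) \<and> (\<forall>N. finite {s. Q s \<le> N})"

lemma proper_finite: "proper Q \<Longrightarrow> finite {s. Q s = N}"
  unfolding proper_def by (rule finite_subset[of _ "{s. Q s \<le> N}"]) auto

lemma proper_scaled_square:
  fixes c :: int
  assumes "c > 0"
  shows "proper (\<lambda>x. c * x\<^sup>2)"
  unfolding proper_def
proof (intro conjI allI)
  show "0 \<le> c * s\<^sup>2" for s using assms by simp
  fix N
  have "{s. c * s\<^sup>2 \<le> N} \<subseteq> {-N..N}"
  proof clarsimp
    fix s :: int
    assume N: "c * s\<^sup>2 \<le> N"
    have "\<bar>s\<bar> \<le> s\<^sup>2"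
      using power_increasing[of 1 2 "\<bar>s\<bar>"] by (cases "s = 0") auto
    also have "s\<^sup>2 \<le> c * s\<^sup>2"
      using assms mult_right_mono[of 1 c "s\<^sup>2"] by simp
    finally show "- N \<le> s \<and> s \<le> N" using N by linarith
  qed
  then show "finite {s. c * s\<^sup>2 \<le> N}" using finite_subset by blast
qed

lemma proper_square: "proper (\<lambda>x :: int. x\<^sup>2)"
  using proper_scaled_square[of 1] by simp

lemma proper_add:
  assumes "proper Q" "proper R"
  shows "proper (\<lambda>(s, t). Q s + R t)"
  unfolding proper_def
proof (intro conjI allI)
  show "0 \<le> (case st of (s, t) \<Rightarrow> Q s + R t)" for st
    using assms by (auto simp: proper_def split: prod.splits)
  fix N
  have "{st. (case st of (s, t) \<Rightarrow> Q s + R t) \<le> N} \<subseteq> {s. Q s \<le> N} \<times> {t. R t \<le> N}"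
  proof clarsimp
    fix s t
    assume "Q s + R t \<le> N"
    moreover have "0 \<le> Q s" "0 \<le> R t" using assms by (auto simp: proper_def)
    ultimately show "Q s \<le> N \<and> R t \<le> N" by linarith
  qed
  then show "finite {st. (case st of (s, t) \<Rightarrow> Q s + R t) \<le> N}"
    using assms unfolding proper_def by (meson finite_SigmaI finite_subset)
qed

lemma proper_mono:
  assumes "proper Q" "\<And>s. 0 \<le> R s" "\<And>s. Q s \<le> c * R s" "c > 0"
  shows "proper R"
  unfolding proper_def
proof (intro conjI allI)
  show "0 \<le> R s" for s by fact
  fix N
  have "Q s \<le> c * N" if "R s \<le> N" for s
    using assms(3)[of s] mult_left_mono[OF that, of c] assms(4) by linarith
  then have "{s. R s \<le> N} \<subseteq> {s. Q s \<le> c * N}" by blast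
  then show "finite {s. R s \<le> N}"
    using assms(1) finite_subset unfolding proper_def by blast
qed

lemma theta_nth: "fps_nth (theta A Q) n = int (card {s \<in> A. Q s = int n})"
  by (simp add: theta_def)

text \<open>Writes coefficients as sums over a whole level set, so that a linear relation between
  theta series of subsets follows from a pointwise relation between their indicators.\<close>

lemma theta_nth_sum:
  assumes "proper Q"
  shows "fps_nth (theta A Q) n = (\<Sum>s | Q s = int n. of_bool (s \<in> A))"
proof -
  have "{s \<in> A. Q s = int n} = {s. Q s = int n} \<inter> A" by auto
  then show ?thesis
    using proper_finite[OF assms] by (simp add: theta_nth of_bool_def sum.If_cases Collect_conj_eq)
qed

lemma theta_mult:
  assumes Q: "proper Q" and R: "proper R"
  shows "theta A Q * theta B R = theta (A \<times> B) (\<lambda>(s, t). Q s + R t)"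
proof (rule fps_ext)
  fix n
  let ?F = "\<lambda>i. {s \<in> A. Q s = int i} \<times> {t \<in> B. R t = int (n - i)}"
  have fin: "finite (?F i)" for i
    using proper_finite[OF Q] proper_finite[OF R] by simp
  have "{st \<in> A \<times> B. (case st of (s, t) \<Rightarrow> Q s + R t) = int n} = (\<Union>i\<in>{0..n}. ?F i)"
  proof (intro equalityI subsetI)
    fix st assume st: "st \<in> {st \<in> A \<times> B. (case st of (s, t) \<Rightarrow> Q s + R t) = int n}"
    obtain s t where "st = (s, t)" by force
    moreover have "0 \<le> Q s" "0 \<le> R t" using Q R by (auto simp: proper_def)
    ultimately have "st \<in> ?F (nat (Q s))" "nat (Q s) \<in> {0..n}"
      using st by auto
    then show "st \<in> (\<Union>i\<in>{0..n}. ?F i)" by blast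
  qed auto
  then have "card {st \<in> A \<times> B. (case st of (s, t) \<Rightarrow> Q s + R t) = int n} = (\<Sum>i=0..n. card (?F i))"
    using fin by (simp only:) (rule card_UN_disjoint, auto simp del: of_nat_diff)
  then show "fps_nth (theta A Q * theta B R) n = fps_nth (theta (A \<times> B) (\<lambda>(s, t). Q s + R t)) n"
    by (simp add: fps_mult_nth theta_nth card_cartesian_product)
qed

lemma theta_bij:
  assumes "\<And>s. s \<in> A \<Longrightarrow> f s \<in> B \<and> g (f s) = s \<and> R (f s) = Q s"
    and "\<And>t. t \<in> B \<Longrightarrow> g t \<in> A \<and> f (g t) = t"
  shows "theta A Q = theta B R"
proof (rule fps_ext)
  fix n
  have "bij_betw f {s \<in> A. Q s = int n} {t \<in> B. R t = int n}"
    by (rule bij_betw_byWitness[where f' = g]) (use assms in \<open>auto, metis\<close>)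
  then show "fps_nth (theta A Q) n = fps_nth (theta B R) n"
    by (simp add: theta_nth bij_betw_same_card)
qed

section \<open>Lattice identities\<close>

text \<open>The norm of the Eisenstein integer \<open>u + v * w\<close>, with \<open>w\<close> a
  primitive sixth root of unity. Multiplication by \<open>w\<close> is the isometry
  \<open>(u, v) \<mapsto> (- v, u + v)\<close>.\<close>

definition hex :: "int \<times> int \<Rightarrow> int" where
  "hex = (\<lambda>(u, v). u\<^sup>2 + u * v + v\<^sup>2)"

lemma proper_scaled_hex:
  assumes "c > 0"
  shows "proper (\<lambda>s. c * hex s)"
proof (rule proper_mono[where c = 2])
  show "proper (\<lambda>(s :: int, t :: int). s\<^sup>2 + t\<^sup>2)"
    using proper_add[OF proper_square proper_square] .
  have *: "u\<^sup>2 + v\<^sup>2 \<le> 2 * (u\<^sup>2 + u * v + v\<^sup>2)" for u v :: int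
  proof -
    have "0 \<le> (u + v)\<^sup>2" by simp
    then show ?thesis by (simp add: power2_eq_square algebra_simps)
  qed
  have pos: "0 \<le> hex s" for s
  proof -
    obtain u v where s: "s = (u, v)" by force
    show ?thesis
      using order_trans[OF _ *[of u v], of 0] by (simp add: s hex_def)
  qed
  show "0 \<le> c * hex s" for s using pos assms by simp
  show "(case s of (s, t) \<Rightarrow> s\<^sup>2 + t\<^sup>2) \<le> 2 * (c * hex s)" for s
  proof -
    have "hex s \<le> c * hex s" using pos[of s] assms mult_right_mono[of 1 c "hex s"] by simp
    then show ?thesis using *[of "fst s" "snd s"] by (auto simp: hex_def case_prod_unfold)
  qed
qed simp

lemma proper_hex: "proper hex"
  using proper_scaled_hex[of 1] by simp

definition phi1 :: "int fps" where "phi1 = theta UNIV (\<lambda>x. x\<^sup>2)"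
definition phi3 :: "int fps" where "phi3 = theta UNIV (\<lambda>x. 3 * x\<^sup>2)"
definition hex_theta :: "int \<Rightarrow> int fps" where "hex_theta c = theta UNIV (\<lambda>s. c * hex s)"

lemma hex_theta_4: "hex_theta 4 = theta {(u, v). even u \<and> even v} hex"
  unfolding hex_theta_def
  by (rule theta_bij[where f = "\<lambda>(u, v). (2 * u, 2 * v)" and g = "\<lambda>(u, v). (u div 2, v div 2)"])
     (auto simp: hex_def power2_eq_square algebra_simps)

lemma hex_theta_1: "hex_theta 1 = theta UNIV hex"
  by (simp add: hex_theta_def)

lemma hex_theta_split:
  "hex_theta 1 = theta {(u, v). even u \<and> even v} hex + theta {(u, v). \<not> (even u \<and> even v)} hex"
  unfolding hex_theta_1
  by (rule fps_ext, simp only: theta_nth_sum[OF proper_hex] fps_add_nth sum.distrib[symmetric])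
     (rule sum.cong, auto)

text \<open>The form \<open>x\<^sup>2 + 3 y\<^sup>2\<close> lives on each of the three sublattices of index 2 of the hexagonal
  lattice; they cover the lattice and pairwise meet in its double.\<close>
lemma phi1_phi3: "3 * (phi1 * phi3) = hex_theta 1 + 2 * hex_theta 4"
proof -
  have "phi1 * phi3 = theta UNIV (\<lambda>(x, y). x\<^sup>2 + 3 * y\<^sup>2)"
    unfolding phi1_def phi3_def
    by (subst theta_mult) (simp_all add: proper_square proper_scaled_square)
  also have "\<dots> = theta {(u, v). even v} hex"
    by (rule theta_bij[where f = "\<lambda>(x, y). (x - y, 2 * y)" and g = "\<lambda>(u, v). (u + v div 2, v div 2)"])
       (auto simp: hex_def power2_eq_square algebra_simps)
  finally have v: "phi1 * phi3 = theta {(u, v). even v} hex" .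
  have u: "theta {(u, v). even v} hex = theta {(u, v). even u} hex"
    by (rule theta_bij[where f = "\<lambda>(u, v). (v, u)" and g = "\<lambda>(u, v). (v, u)"])
       (auto simp: hex_def algebra_simps)
  have uv: "theta {(u, v). even v} hex = theta {(u, v). even (u + v)} hex"
    by (rule theta_bij[where f = "\<lambda>(u, v). (u + v, - u)" and g = "\<lambda>(u, v). (- v, u + v)"])
       (auto simp: hex_def power2_eq_square algebra_simps)
  have "theta {(u, v). even v} hex + theta {(u, v). even u} hex + theta {(u, v). even (u + v)} hex
      = hex_theta 1 + 2 * hex_theta 4"
    unfolding hex_theta_4 hex_theta_1
    by (rule fps_ext, simp only: theta_nth_sum[OF proper_hex] fps_add_nth numeral_fps_const
           fps_mult_left_const_nth sum.distrib[symmetric] sum_distrib_left)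
       (rule sum.cong, auto)
  then show ?thesis using u uv v by (simp add: algebra_simps)
qed

text \<open>Via \<open>(s, t) \<mapsto> (s + t, s - t)\<close> the left-hand side counts pairs that agree modulo 2. Over the field
  of four elements, any two nonzero residues differ by exactly one of the three units.\<close>
lemma hex_theta_2_squared:
  "3 * hex_theta 2 ^ 2 = (hex_theta 1 - hex_theta 4) ^ 2 + 3 * hex_theta 4 ^ 2"
proof -
  let ?H = "\<lambda>(s, t). hex s + hex t"
  let ?E = "{(u :: int, v :: int). even u \<and> even v}"
  let ?O = "{(u :: int, v :: int). \<not> (even u \<and> even v)}"
  let ?D0 = "{((u1 :: int, u2 :: int), (v1 :: int, v2 :: int)). even (u1 + v1) \<and> even (u2 + v2)}"
  let ?D1 = "{((u1 :: int, u2 :: int), (v1 :: int, v2 :: int)). even (u1 + v2) \<and> even (u2 + v1 + v2)}"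
  let ?D2 = "{((u1 :: int, u2 :: int), (v1 :: int, v2 :: int)). even (u1 + v1 + v2) \<and> even (u2 + v1)}"
  have H: "proper ?H" by (rule proper_add[OF proper_hex proper_hex])
  have half: "(v - u) div 2 + (u + v) div 2 = v" "(v - u) div 2 + (v + u) div 2 = v"
    if "even u \<longleftrightarrow> even v" for u v :: int
    using that by presburger+
  have "hex_theta 2 ^ 2 = theta UNIV (\<lambda>(s, t). 2 * hex s + 2 * hex t)"
    unfolding hex_theta_def power2_eq_square
    by (subst theta_mult) (simp_all add: proper_scaled_hex)
  also have "\<dots> = theta ?D0 ?H"
    by (rule theta_bij[where f = "\<lambda>((s1, s2), (t1, t2)). ((s1 + t1, s2 + t2), (s1 - t1, s2 - t2))"
          and g = "\<lambda>((u1, u2), (v1, v2)). (((u1 + v1) div 2, (u2 + v2) div 2), ((u1 - v1) div 2, (u2 - v2) div 2))"])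
       (auto simp: hex_def power2_eq_square algebra_simps half)
  finally have D0: "hex_theta 2 ^ 2 = theta ?D0 ?H" .
  \<comment> \<open>Dividing the second member by \<open>w\<close>, or by its square for
    \<open>?D2\<close>, turns agreement modulo 2 into agreement up to that unit.\<close>
  have D1: "theta ?D0 ?H = theta ?D1 ?H"
    by (rule theta_bij[where f = "\<lambda>(u, (v1, v2)). (u, (v1 + v2, - v1))"
          and g = "\<lambda>(u, (v1, v2)). (u, (- v2, v1 + v2))"])
       (auto simp: hex_def power2_eq_square algebra_simps)
  have D2: "theta ?D0 ?H = theta ?D2 ?H"
    by (rule theta_bij[where f = "\<lambda>(u, (v1, v2)). (u, (v2, - v1 - v2))"
          and g = "\<lambda>(u, (v1, v2)). (u, (- v1 - v2, v1))"])
       (auto simp: hex_def power2_eq_square algebra_simps)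
  \<comment> \<open>Pairs in \<open>?E \<times> ?E\<close> lie in all three sets, pairs with just
    one member in \<open>?E\<close> in none.\<close>
  have "theta ?D0 ?H + theta ?D1 ?H + theta ?D2 ?H = theta (?O \<times> ?O) ?H + 3 * theta (?E \<times> ?E) ?H"
    by (rule fps_ext, simp only: theta_nth_sum[OF H] fps_add_nth numeral_fps_const
           fps_mult_left_const_nth sum.distrib[symmetric] sum_distrib_left)
       (rule sum.cong, auto)
  also have "theta (?O \<times> ?O) ?H = (hex_theta 1 - hex_theta 4) ^ 2"
    unfolding hex_theta_split hex_theta_4
    by (simp add: power2_eq_square theta_mult proper_hex)
  also have "theta (?E \<times> ?E) ?H = hex_theta 4 ^ 2"
    unfolding hex_theta_4 by (simp add: power2_eq_square theta_mult proper_hex)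
  finally show ?thesis using D0 D1 D2 by simp
qed

text \<open>Splits a vector orthogonally along \<open>(1, 1, 1)\<close>: a third of the coordinate
  sum contributes \<open>3 * z\<^sup>2\<close>, and the rest \<open>(u, v, - u - v)\<close> has norm
  \<open>2 * hex (u, v)\<close>.\<close>

lemma hex_theta_2_phi3:
  "hex_theta 2 * phi3 = theta {(x, y, z). 3 dvd x + y + z} (\<lambda>(x, y, z). x\<^sup>2 + y\<^sup>2 + z\<^sup>2)"
proof -
  have "hex_theta 2 * phi3 = theta UNIV (\<lambda>(s, z). 2 * hex s + 3 * z\<^sup>2)"
    unfolding hex_theta_def phi3_def
    by (subst theta_mult) (simp_all add: proper_scaled_hex proper_scaled_square)
  also have "\<dots> = theta {(x, y, z). 3 dvd x + y + z} (\<lambda>(x, y, z). x\<^sup>2 + y\<^sup>2 + z\<^sup>2)"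
    by (rule theta_bij[where f = "\<lambda>((u, v), z). (z + u, z + v, z - u - v)"
          and g = "\<lambda>(x, y, z). ((x - (x + y + z) div 3, y - (x + y + z) div 3), (x + y + z) div 3)"])
       (auto simp: hex_def power2_eq_square algebra_simps)
  finally show ?thesis .
qed

lemma phi1_cubed: "phi1 ^ 3 = theta UNIV (\<lambda>(x, y, z). x\<^sup>2 + y\<^sup>2 + z\<^sup>2)"
proof -
  have "phi1 ^ 3 = phi1 * (phi1 * phi1)" by (simp add: power3_eq_cube mult.assoc)
  also have "\<dots> = theta UNIV (\<lambda>(x, y, z). x\<^sup>2 + y\<^sup>2 + z\<^sup>2)"
    by (simp add: phi1_def theta_mult proper_square proper_add) (simp add: case_prod_unfold add.assoc)
  finally show ?thesis .
qed

text \<open>Modulo 3, the four conditions cut out the planes orthogonal to the four points of a totally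
  isotropic line of the quadric \<open>a\<^sup>2 + b\<^sup>2 + c\<^sup>2 + d\<^sup>2 = 0\<close>. A vector lies in exactly one of them,
  or in all four if it lies on the line itself; the sublattice of the latter vectors is
  \<open>\<int>\<^sup>4\<close> scaled by 3.\<close>
lemma four_hex_theta_2_phi1_phi3:
  "4 * (hex_theta 2 * phi1 * phi3) = phi1 ^ 4 + 3 * phi3 ^ 4"
proof -
  let ?S = "\<lambda>(a :: int, b :: int, c :: int, d :: int). a\<^sup>2 + (b\<^sup>2 + (c\<^sup>2 + d\<^sup>2))"
  let ?L1 = "{(a :: int, b :: int, c :: int, d :: int). 3 dvd b + c + d}"
  let ?L2 = "{(a :: int, b :: int, c :: int, d :: int). 3 dvd a + c - d}"
  let ?L3 = "{(a :: int, b :: int, c :: int, d :: int). 3 dvd a + b - c}"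
  let ?L4 = "{(a :: int, b :: int, c :: int, d :: int). 3 dvd a - b + d}"
  let ?L = "{(a :: int, b :: int, c :: int, d :: int). 3 dvd b + c + d \<and> 3 dvd a + c - d}"
  have S: "proper ?S"
    using proper_add[OF proper_square proper_add[OF proper_square proper_add[OF proper_square proper_square]]]
    by (simp add: case_prod_unfold)
  have "phi1 * (hex_theta 2 * phi3) = theta ?L1 ?S"
    unfolding hex_theta_2_phi3 phi1_def
    by (subst theta_mult)
       (use proper_add[OF proper_square proper_add[OF proper_square proper_square]] in
        \<open>auto simp: proper_square case_prod_unfold add.assoc intro!: arg_cong2[where f = theta]\<close>)
  then have L1: "hex_theta 2 * phi1 * phi3 = theta ?L1 ?S" by (simp add: algebra_simps)
  have L2: "theta ?L1 ?S = theta ?L2 ?S"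
    by (rule theta_bij[where f = "\<lambda>(a, b, c, d). (b, a, c, - d)" and g = "\<lambda>(a, b, c, d). (b, a, c, - d)"]) auto
  have L3: "theta ?L1 ?S = theta ?L3 ?S"
    by (rule theta_bij[where f = "\<lambda>(a, b, c, d). (b, c, - d, a)" and g = "\<lambda>(a, b, c, d). (d, a, b, - c)"]) auto
  have L4: "theta ?L1 ?S = theta ?L4 ?S"
    by (rule theta_bij[where f = "\<lambda>(a, b, c, d). (b, - c, a, d)" and g = "\<lambda>(a, b, c, d). (c, a, - b, d)"]) auto
  have "phi3 ^ 4 = phi3 * (phi3 * (phi3 * phi3))"
    by (simp add: power4_eq_xxxx mult.assoc)
  also have "\<dots> = theta UNIV (\<lambda>(a, b, c, d). 3 * a\<^sup>2 + (3 * b\<^sup>2 + (3 * c\<^sup>2 + 3 * d\<^sup>2)))"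
    by (simp add: phi3_def theta_mult proper_scaled_square proper_add) (simp add: case_prod_unfold)
  also have "\<dots> = theta ?L ?S"
  \<comment> \<open>The coefficient vectors of the four conditions form a symmetric matrix M with
    M^2 = 3 I; \<open>f\<close> is M and \<open>g\<close> is M / 3.\<close>
  proof (rule theta_bij[where
          f = "\<lambda>(p, q, r, s). (q + r + s, p + r - s, p + q - r, p - q + s)" and
          g = "\<lambda>(a, b, c, d). ((b + c + d) div 3, (a + c - d) div 3, (a + b - c) div 3, (a - b + d) div 3)"],
      goal_cases)
    case (1 t)
    obtain p q r s where t: "t = (p, q, r, s)" by (metis surj_pair)
    have "(q + r + s)\<^sup>2 + ((p + r - s)\<^sup>2 + ((p + q - r)\<^sup>2 + (p - q + s)\<^sup>2))
        = 3 * p\<^sup>2 + (3 * q\<^sup>2 + (3 * r\<^sup>2 + 3 * s\<^sup>2))"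
      by (simp add: power2_eq_square algebra_simps)
    then show ?case unfolding t by auto
  next
    case (2 t)
    obtain a b c d where t: "t = (a, b, c, d)" by (metis surj_pair)
    obtain p q where pq: "b + c + d = 3 * p" "a + c - d = 3 * q"
      using 2 unfolding t by (auto elim!: dvdE)
    have rs: "a + b - c = 3 * (p + q - c)" "a - b + d = 3 * (q - p + d)"
      using pq by algebra+
    have "(b + c + d) div 3 = p" "(a + c - d) div 3 = q"
      "(a + b - c) div 3 = p + q - c" "(a - b + d) div 3 = q - p + d"
      unfolding pq rs by simp_all
    then show ?case using pq unfolding t by simp
  qed
  finally have L: "phi3 ^ 4 = theta ?L ?S" .
  have one: "phi1 ^ 4 = theta UNIV ?S"
  proof -
    have "phi1 ^ 4 = phi1 * (phi1 * (phi1 * phi1))" by (simp add: power4_eq_xxxx mult.assoc)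
    also have "\<dots> = theta UNIV ?S"
      by (simp add: phi1_def theta_mult proper_square proper_add) (simp add: case_prod_unfold)
    finally show ?thesis .
  qed
  have "of_bool (s \<in> ?L1) + of_bool (s \<in> ?L2) + of_bool (s \<in> ?L3) + of_bool (s \<in> ?L4)
      = (1 :: int) + 3 * of_bool (s \<in> ?L)" for s
  proof -
    obtain a b c d where s: "s = (a, b, c, d)" by (metis surj_pair)
    have "3 dvd a + b - c \<longleftrightarrow> 3 dvd (b + c + d) + (a + c - d)"
      "3 dvd a - b + d \<longleftrightarrow> 3 dvd (a + c - d) - (b + c + d)"
      by presburger+
    \<comment> \<open>Up to sign these are all the nonzero linear forms on the plane over the field
      of three elements; a nonzero vector is a zero of exactly one.\<close>
    moreover have "of_bool (3 dvd u) + of_bool (3 dvd v) + of_bool (3 dvd u + v) + of_bool (3 dvd v - u)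
        = (1 :: int) + 3 * of_bool (3 dvd u \<and> 3 dvd v)" for u v :: int
      unfolding of_bool_def by presburger
    ultimately show ?thesis unfolding s by (simp only: mem_Collect_eq prod.case)
  qed
  then have "theta ?L1 ?S + theta ?L2 ?S + theta ?L3 ?S + theta ?L4 ?S = theta UNIV ?S + 3 * theta ?L ?S"
    by (intro fps_ext)
       (simp only: theta_nth_sum[OF S] fps_add_nth numeral_fps_const fps_mult_left_const_nth
          sum.distrib[symmetric] sum_distrib_left UNIV_I, simp)
  then show ?thesis using L1 L2 L3 L4 L one by simp
qed

section \<open>Constant terms and elimination\<close>

lemma phi_nth_0:
  "fps_nth phi1 0 = 1" "fps_nth phi3 0 = 1"
  by (simp_all add: phi1_def phi3_def theta_nth)

lemma hex_eq_0_iff: "hex s = 0 \<longleftrightarrow> s = (0, 0)"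
proof
  assume "hex s = 0"
  moreover obtain u v where s: "s = (u, v)" by force
  ultimately have "u\<^sup>2 + v\<^sup>2 + (u + v)\<^sup>2 = 0"
    by (simp add: hex_def power2_eq_square algebra_simps)
  then have "u\<^sup>2 = 0" "v\<^sup>2 = 0"
    using zero_le_power2[of u] zero_le_power2[of v] zero_le_power2[of "u + v"] by linarith+
  then show "s = (0, 0)" using s by simp
qed (simp add: hex_def)

lemma hex_theta_nth_0: "c \<noteq> 0 \<Longrightarrow> fps_nth (hex_theta c) 0 = 1"
  by (simp add: hex_theta_def theta_nth hex_eq_0_iff)

lemma phi1_cubed_eq: "phi1 ^ 3 = phi3 * (2 * hex_theta 2 + hex_theta 1 - 2 * hex_theta 4)"
proof -
  define x y a b c where "x = phi1" "y = phi3" "a = hex_theta 1" "b = hex_theta 2" "c = hex_theta 4"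
  note defs = this
  have e1: "3 * (x * y) = a + 2 * c" and e2: "4 * (b * x * y) = x ^ 4 + 3 * y ^ 4"
    and e3: "3 * b ^ 2 = (a - c) ^ 2 + 3 * c ^ 2"
    unfolding defs by (fact phi1_phi3 four_hex_theta_2_phi1_phi3 hex_theta_2_squared)+
  \<comment> \<open>By \<open>e2\<close> the square on the left is
    \<open>16 * b^2 * x^2 * y^2 - 12 * x^4 * y^4\<close>; the factor 3 makes \<open>e3\<close> and
    \<open>e1\<close> applicable.\<close>
  have "3 * (x ^ 4 - 3 * y ^ 4)\<^sup>2 = 3 * (2 * (x * y) * (a - 2 * c))\<^sup>2"
    using e1 e2 e3 by algebra
  then have "x ^ 4 - 3 * y ^ 4 = 2 * (x * y) * (a - 2 * c) \<or> x ^ 4 - 3 * y ^ 4 = - (2 * (x * y) * (a - 2 * c))"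
    by (simp add: power2_eq_iff)
  \<comment> \<open>The constant terms are -2 and 2.\<close>
  moreover have "fps_nth (x ^ 4 - 3 * y ^ 4) 0 \<noteq> fps_nth (- (2 * (x * y) * (a - 2 * c))) 0"
    by (simp add: defs phi_nth_0 hex_theta_nth_0 fps_nth_power_0)
  ultimately have "x ^ 4 - 3 * y ^ 4 = 2 * (x * y) * (a - 2 * c)" by metis
  \<comment> \<open>Adding \<open>e2\<close> removes \<open>y ^ 4\<close>.\<close>
  then have "2 * x * x ^ 3 = 2 * x * (y * (2 * b + a - 2 * c))"
    using e2 by algebra
  moreover have "2 * x \<noteq> 0"
    using phi_nth_0(1) unfolding defs by auto
  ultimately show ?thesis unfolding defs by simp
qed

section \<open>Spheres of radius divisible by three\<close>

lemma three_squares_reps_eq: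
  "int (three_squares_reps n) = fps_nth (theta UNIV (\<lambda>(x, y, z). x\<^sup>2 + y\<^sup>2 + z\<^sup>2)) n"
  by (simp add: theta_nth three_squares_reps_def case_prod_unfold)

text \<open>A vector of norm divisible by 9 has all or none of its coordinates divisible by 3. In the latter
  case it is congruent to a multiple of exactly one of the four vectors \<open>(1, \<plusminus>1, \<plusminus>1)\<close>, and reflecting
  in that vector makes it divisible by 3.\<close>
lemma three_squares_reps_9:
  "int (three_squares_reps (9 * n)) = 5 * int (three_squares_reps n) - 4 * fps_nth (hex_theta 2 * phi3) n"
proof -
  let ?S = "\<lambda>(x :: int, y :: int, z :: int). x\<^sup>2 + y\<^sup>2 + z\<^sup>2"
  let ?V = "\<lambda>e f. {(x :: int, y :: int, z :: int). \<not> 3 dvd x \<and> 3 dvd x - e * y \<and> 3 dvd x - f * z \<and> 9 dvd ?S (x, y, z)}"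
  let ?Z = "{(x :: int, y :: int, z :: int). 3 dvd x \<and> 3 dvd y \<and> 3 dvd z}"
  let ?N = "{(x :: int, y :: int, z :: int). \<not> 3 dvd x + y + z}"
  have S: "proper ?S"
    using proper_add[OF proper_square proper_add[OF proper_square proper_square]]
    by (simp add: case_prod_unfold add.assoc)
  have scale: "fps_nth (theta A (\<lambda>s. 9 * Q s)) (9 * n) = fps_nth (theta A Q) n" for A :: "'b set" and Q
    by (simp add: theta_nth)
  have Z: "theta ?Z ?S = theta UNIV (\<lambda>s. 9 * ?S s)"
    by (rule theta_bij[where f = "\<lambda>(x, y, z). (x div 3, y div 3, z div 3)" and g = "\<lambda>(x, y, z). (3 * x, 3 * y, 3 * z)"])
       (auto simp: power2_eq_square elim!: dvdE)
  have V: "theta ?N (\<lambda>s. 9 * ?S s) = theta (?V 1 1) ?S"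
  \<comment> \<open>\<open>f\<close> is three times the reflection in \<open>(1, 1, 1)\<close>, so
    applying it twice multiplies by 9, and \<open>g\<close> is \<open>f\<close> divided by
    9.\<close>
  proof (rule theta_bij[where
        f = "\<lambda>(x, y, z). (x - 2 * y - 2 * z, y - 2 * x - 2 * z, z - 2 * x - 2 * y)" and
        g = "\<lambda>(x, y, z). ((x - 2 * y - 2 * z) div 9, (y - 2 * x - 2 * z) div 9, (z - 2 * x - 2 * y) div 9)"],
      goal_cases)
    case (1 s)
    obtain x y z where s: "s = (x, y, z)" by (metis surj_pair)
    have "?S (x - 2 * y - 2 * z, y - 2 * x - 2 * z, z - 2 * x - 2 * y) = 9 * ?S (x, y, z)"
      by (simp add: power2_eq_square algebra_simps)
    moreover have "\<not> 3 dvd x - 2 * y - 2 * z" using 1 unfolding s by (simp, presburger)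
    moreover have "3 dvd (x - 2 * y - 2 * z) - 1 * (y - 2 * x - 2 * z)"
      "3 dvd (x - 2 * y - 2 * z) - 1 * (z - 2 * x - 2 * y)" by presburger+
    moreover have "(x - 2 * y - 2 * z - 2 * (y - 2 * x - 2 * z) - 2 * (z - 2 * x - 2 * y)) div 9 = x"
      "(y - 2 * x - 2 * z - 2 * (x - 2 * y - 2 * z) - 2 * (z - 2 * x - 2 * y)) div 9 = y"
      "(z - 2 * x - 2 * y - 2 * (x - 2 * y - 2 * z) - 2 * (y - 2 * x - 2 * z)) div 9 = z"
      by presburger+
    ultimately show ?case unfolding s by simp
  next
    case (2 t)
    obtain x y z where t: "t = (x, y, z)" by (metis surj_pair)
    have h: "\<not> 3 dvd x" "3 dvd x - y" "3 dvd x - z" "9 dvd x\<^sup>2 + y\<^sup>2 + z\<^sup>2"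
      using 2 unfolding t by auto
    obtain k l where kl: "y = x - 3 * k" "z = x - 3 * l"
      using h(2,3) by (metis add_diff_cancel_left' diff_add_cancel dvdE)
    have "x\<^sup>2 + y\<^sup>2 + z\<^sup>2 = 3 * (x * (x - 2 * (k + l))) + 9 * (k\<^sup>2 + l\<^sup>2)"
      unfolding kl by (simp add: power2_eq_square algebra_simps)
    then have "9 dvd 3 * (x * (x - 2 * (k + l)))"
      using h(4) by (simp add: dvd_add_left_iff)
    moreover have "3 dvd w" if "9 dvd 3 * w" for w :: int using that by presburger
    ultimately have "3 dvd x * (x - 2 * (k + l))" by blast
    moreover have "prime (3 :: int)" by simp
    ultimately have "3 dvd x - 2 * (k + l)" using h(1) prime_dvd_mult_iff by blast
    then obtain m where m: "x = 2 * (k + l) + 3 * m" by (metis diff_add_cancel add.commute dvdE)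
    \<comment> \<open>The witnesses are the values of \<open>g\<close>, rewritten in
      \<open>k\<close>, \<open>l\<close>, \<open>m\<close>.\<close>
    have "\<exists>p q r. x = p - 2 * q - 2 * r \<and> y = q - 2 * p - 2 * r \<and> z = r - 2 * p - 2 * q"
      by (rule exI[of _ "- m"], rule exI[of _ "- m - k"], rule exI[of _ "- m - l"])
         (simp add: kl m)
    then obtain p q r where pqr: "x = p - 2 * q - 2 * r" "y = q - 2 * p - 2 * r" "z = r - 2 * p - 2 * q"
      by blast
    have "(x - 2 * y - 2 * z) div 9 = p" "(y - 2 * x - 2 * z) div 9 = q" "(z - 2 * x - 2 * y) div 9 = r"
      unfolding pqr by presburger+
    moreover have "\<not> 3 dvd p + q + r" using h(1) unfolding pqr by presburger
    ultimately show ?case unfolding t using pqr by simp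
  qed
  have V1: "theta (?V 1 1) ?S = theta (?V 1 (-1)) ?S"
    by (rule theta_bij[where f = "\<lambda>(x, y, z). (x, y, - z)" and g = "\<lambda>(x, y, z). (x, y, - z)"]) auto
  have V2: "theta (?V 1 1) ?S = theta (?V (-1) 1) ?S"
    by (rule theta_bij[where f = "\<lambda>(x, y, z). (x, - y, z)" and g = "\<lambda>(x, y, z). (x, - y, z)"]) auto
  have V3: "theta (?V 1 1) ?S = theta (?V (-1) (-1)) ?S"
    by (rule theta_bij[where f = "\<lambda>(x, y, z). (x, - y, - z)" and g = "\<lambda>(x, y, z). (x, - y, - z)"]) auto
  have "(1 :: int) = of_bool (s \<in> ?Z) + of_bool (s \<in> ?V 1 1) + of_bool (s \<in> ?V 1 (-1))
      + of_bool (s \<in> ?V (-1) 1) + of_bool (s \<in> ?V (-1) (-1))" if "?S s = int (9 * n)" for s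
  proof -
    obtain x y z where s: "s = (x, y, z)" by (metis surj_pair)
    have 9: "9 dvd x\<^sup>2 + y\<^sup>2 + z\<^sup>2" using that unfolding s by simp
    then have "3 dvd x\<^sup>2 + y\<^sup>2 + z\<^sup>2" by presburger
    then have "(x\<^sup>2 mod 3 + (y\<^sup>2 mod 3 + z\<^sup>2 mod 3) mod 3) mod 3 = 0"
      by (simp only: mod_add_eq add.assoc dvd_eq_mod_eq_0)
    moreover have "w\<^sup>2 mod 3 = (if 3 dvd w then 0 else 1)" for w :: int
    proof -
      have "w mod 3 = 0 \<or> w mod 3 = 1 \<or> w mod 3 = 2" by presburger
      then have "(w mod 3)\<^sup>2 mod 3 = (if w mod 3 = 0 then 0 else 1)" by auto
      then show ?thesis by (simp add: power_mod dvd_eq_mod_eq_0)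
    qed
    ultimately have xyz: "(3 dvd x \<longleftrightarrow> 3 dvd y) \<and> (3 dvd x \<longleftrightarrow> 3 dvd z)"
      by (simp split: if_splits)
    show ?thesis
    proof (cases "3 dvd x")
      case True
      then show ?thesis using xyz unfolding s by auto
    next
      case False
      moreover have "3 dvd x - y \<longleftrightarrow> \<not> 3 dvd x + y" "3 dvd x - z \<longleftrightarrow> \<not> 3 dvd x + z"
        using False xyz by presburger+
      ultimately show ?thesis
        using xyz 9 unfolding s by (cases "3 dvd x + y"; cases "3 dvd x + z") simp_all
    qed
  qed
  then have "fps_nth (theta UNIV ?S) (9 * n) = fps_nth (theta ?Z ?S) (9 * n)
      + fps_nth (theta (?V 1 1) ?S) (9 * n) + fps_nth (theta (?V 1 (-1)) ?S) (9 * n)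
      + fps_nth (theta (?V (-1) 1) ?S) (9 * n) + fps_nth (theta (?V (-1) (-1)) ?S) (9 * n)"
    by (simp only: theta_nth_sum[OF S] sum.distrib[symmetric])
       (rule sum.cong, auto)
  also have "\<dots> = fps_nth (theta UNIV ?S) n + 4 * fps_nth (theta ?N ?S) n"
    unfolding V1[symmetric] V2[symmetric] V3[symmetric] V[symmetric] Z scale by simp
  also have "fps_nth (theta ?N ?S) n = fps_nth (theta UNIV ?S) n - fps_nth (hex_theta 2 * phi3) n"
    unfolding hex_theta_2_phi3 theta_nth_sum[OF S] sum_subtractf[symmetric]
    by (rule sum.cong) auto
  finally show ?thesis by (simp add: three_squares_reps_eq)
qed

theorem theorem1p2:
  fixes n :: nat
  assumes "n mod 4 = 1 \<or> n mod 4 = 2"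
  shows "int (three_squares_reps (9 * n)) - 3 * int (three_squares_reps n)
         = 2 * int (ternary_reps 1 1 3 0 0 1 n)"
proof -
  have "hex_theta 4 * phi3 = theta UNIV (\<lambda>(s, z). 4 * hex s + 3 * z\<^sup>2)"
    unfolding hex_theta_def phi3_def
    by (subst theta_mult) (simp_all add: proper_scaled_hex proper_scaled_square)
  moreover have "4 * h + 3 * z\<^sup>2 \<noteq> int n" for h z :: int
  proof -
    have "z\<^sup>2 mod 4 = 0 \<or> z\<^sup>2 mod 4 = 1"
    proof -
      have "z mod 4 = 0 \<or> z mod 4 = 1 \<or> z mod 4 = 2 \<or> z mod 4 = 3" by presburger
      then have "(z mod 4)\<^sup>2 mod 4 = 0 \<or> (z mod 4)\<^sup>2 mod 4 = 1" by auto
      then show ?thesis by (simp add: power_mod)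
    qed
    then show ?thesis using assms by presburger
  qed
  ultimately have 4: "fps_nth (hex_theta 4 * phi3) n = 0"
    by (simp add: theta_nth case_prod_unfold)
  have "hex_theta 1 * phi3 = theta UNIV (\<lambda>(s, z). hex s + 3 * z\<^sup>2)"
    unfolding hex_theta_def phi3_def
    by (subst theta_mult) (simp_all add: proper_hex proper_scaled_square)
  also have "\<dots> = theta UNIV (\<lambda>(x, y, z). x\<^sup>2 + y\<^sup>2 + 3 * z\<^sup>2 + x * y)"
    by (rule theta_bij[where f = "\<lambda>((x, y), z). (x, y, z)" and g = "\<lambda>(x, y, z). ((x, y), z)"])
       (auto simp: hex_def)
  finally have 1: "fps_nth (hex_theta 1 * phi3) n = int (ternary_reps 1 1 3 0 0 1 n)"
    by (simp add: theta_nth ternary_reps_def case_prod_unfold)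
  have "phi1 ^ 3 = 2 * (hex_theta 2 * phi3) + hex_theta 1 * phi3 - 2 * (hex_theta 4 * phi3)"
    unfolding phi1_cubed_eq by (simp add: algebra_simps)
  then have "fps_nth (phi1 ^ 3) n
      = 2 * fps_nth (hex_theta 2 * phi3) n + fps_nth (hex_theta 1 * phi3) n - 2 * fps_nth (hex_theta 4 * phi3) n"
    by (simp add: numeral_fps_const)
  \<comment> \<open>With T and R the coefficients of \<open>hex_theta 2 * phi3\<close> and
    \<open>hex_theta 1 * phi3\<close>, s(n) = 2 T + R and s(9n) = 5 s(n) - 4 T, so s(9n) - 3 s(n) =
    2 s(n) - 4 T = 2 R.\<close>
  then show ?thesis
    using 1 4 three_squares_reps_9[of n] by (simp add: three_squares_reps_eq phi1_cubed)
qed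

end
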